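(* Let $(\mathcal{C},\lambda)$ be a $(2n+1)$-dimensional contact manifold with canonical coordinates $(x,p,z)$, $\lambda=dz-p_a\,dx^a$, and let $\psi$ be a strictly convex function of $x$ only such that the Legendre submanifold generated by $\psi$ is simply connected. Let $p'=\{p'_1,\dots,p'_n\}$ and $p''=\{p''_1,\dots,p''_n\}$ be two sets of constants, and let $\{g^{ab}(x)\}$ be the metric components $g^{ab}=\partial^2\varphi/\partial p_a\partial p_b$ with the arguments written in terms of $x$, where $\varphi$ is the total Legendre transform of $\psi$. Set $$F^a(x)=g^{aj}(x)\,(p''_j-p'_j),\qquad a\in\{1,\dots,n\}.$$ Then the restricted contact Hamiltonian vector field $X_h|_{h=0}$ associated to $$h(x,p,z)=\Big(\frac{\partial\psi}{\partial x^a}(x)-p_a\Big)F^a(x)+\Gamma(\psi(x)-z),$$ where $\Gamma$ is a function of one variable with $\Gamma(0)=0$ and $\Gamma(s)\neq0$ for $s\neq0$, gives the $\nabla^*$-geodesic curve connecting the two points whose $\nabla^*$-affine coordinates are $p'$ and $p''$.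
   Context: All objects are smooth, repeated indices are summed over $1,\dots,n$, and everything is expressed in the canonical coordinates. For a function $h$ on $\mathcal{C}$, the contact Hamiltonian vector field $X_h$ is defined by $\iota_{X_h}\lambda=h$, $\iota_{X_h}d\lambda=-(dh-(\mathcal{R}h)\lambda)$ with $\mathcal{R}=\partial/\partial z$; in coordinates $\dot x^a=-\partial h/\partial p_a$, $\dot p_a=\partial h/\partial x^a+p_a\,\partial h/\partial z$, $\dot z=h-p_a\,\partial h/\partial p_a$. The embedded Legendre submanifold generated by $\psi$ is $\mathcal{A}_\psi^{\mathcal{C}}=\{(x,p,z): p_a=\partial\psi/\partial x^a,\ z=\psi(x)\}$. The restricted contact Hamiltonian vector field $X_h|_{h=0}$ is the restriction of $X_h$ to $h=0$, taken as the vector field on $\mathcal{A}_\psi^{\mathcal{C}}$ with components $\dot x^a=F^a(x)$, $\dot p_a=\frac{d}{dt}(\partial\psi/\partial x^a)$, $\dot z=d\psi/dt$. The total Legendre transform is $\varphi(p)=\sup_x[x^ap_a-\psi(x)]$. $\mathcal{A}_\psi^{\mathcal{C}}$ carries the following dually flat structure: the Riemannian metric $g=g_{ab}\,dx^a\otimes dx^b$, $g_{ab}=\partial^2\psi/\partial x^a\partial x^b$, with $g_{aj}g^{jb}=\delta_a^b$; the flat connection $\nabla$ whose connection coefficients vanish in the coordinates $x$ (so $x$ are $\nabla$-affine coordinates and $g=\nabla d\psi$); and the dual connection $\nabla^*$, determined by $Z[g(X,Y)]=g(\nabla_ZX,Y)+g(X,\nabla^*_ZY)$ for all vector fields $X,Y,Z$.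 The functions $p_a=\partial\psi/\partial x^a$ are $\nabla^*$-affine coordinates, i.e. the connection coefficients of $\nabla^*$ vanish in the coordinates $p$.
   Formalization: Existence of the connecting ∇*-geodesic is asserted only if ψ is defined on all of R^n or the segment from p' to p'' lies in the range of the coordinates p; without this, which is also necessary, no such geodesic exists. *)

theory Defs
  imports "HOL-Analysis.Analysis"
begin

subsection \<open>Smooth functions and partial derivatives on open sets\<close>

fun Ck_on :: "nat \<Rightarrow> ('a::euclidean_space \<Rightarrow> 'b::real_normed_vector) \<Rightarrow> 'a set \<Rightarrow> bool" where
  "Ck_on 0 f U \<longleftrightarrow> continuous_on U f"
| "Ck_on (Suc k) f U \<longleftrightarrow> f differentiable_on U \<and>
     (\<forall>i\<in>Basis. Ck_on k (\<lambda>x. frechet_derivative f (at x) i) U)"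

definition smooth_on :: "('a::euclidean_space \<Rightarrow> 'b::real_normed_vector) \<Rightarrow> 'a set \<Rightarrow> bool" where
  "smooth_on f U \<longleftrightarrow> (\<forall>k. Ck_on k f U)"

definition pd :: "'n::finite \<Rightarrow> (real^'n \<Rightarrow> real) \<Rightarrow> real^'n \<Rightarrow> real" where
  "pd a f x = frechet_derivative f (at x) (axis a 1)"

definition grad :: "(real^'n::finite \<Rightarrow> real) \<Rightarrow> real^'n \<Rightarrow> real^'n" where
  "grad f x = (\<chi> a. pd a f x)"

definition hess :: "(real^'n::finite \<Rightarrow> real) \<Rightarrow> real^'n \<Rightarrow> real^'n^'n" where
  "hess f x = (\<chi> a b. pd a (pd b f) x)"

definition strictly_convex_on :: "'a::real_vector set \<Rightarrow> ('a \<Rightarrow> real) \<Rightarrow> bool" where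
  "strictly_convex_on U f \<longleftrightarrow> convex U \<and>
     (\<forall>x\<in>U. \<forall>y\<in>U. \<forall>t. x \<noteq> y \<and> 0 < t \<and> t < 1 \<longrightarrow>
        f ((1 - t) *\<^sub>R x + t *\<^sub>R y) < (1 - t) * f x + t * f y)"

text \<open>The supremum is over the domain \<open>U\<close> of \<open>\<psi>\<close>. It is meaningful at those \<open>p\<close>
  where it is finite, in particular on the open set \<open>grad \<psi> ` U\<close>.\<close>

definition legendre_transform ::
    "(real^'n::finite) set \<Rightarrow> (real^'n \<Rightarrow> real) \<Rightarrow> real^'n \<Rightarrow> real" where
  "legendre_transform U \<psi> p = (SUP x\<in>U. x \<bullet> p - \<psi> x)"


subsection \<open>Contact geometry in canonical coordinates\<close>

text \<open>Points and tangent vectors are triples \<open>(x, p, z)\<close> of canonical coordinates,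
  respectively of components in these coordinates.\<close>

type_synonym 'n pt = "(real^'n) \<times> (real^'n) \<times> real"

definition contact_form :: "'n::finite pt \<Rightarrow> 'n pt \<Rightarrow> real" where
  "contact_form = (\<lambda>(x, p, z) (dx, dp, dz). dz - p \<bullet> dx)"

text \<open>Exterior derivative of a one-form, evaluated on constant vector fields \<open>u\<close>, \<open>v\<close>
  (which commute): \<open>d\<alpha>(u, v) = u(\<alpha>(v)) - v(\<alpha>(u))\<close>.\<close>

definition ext_deriv :: "('a::real_normed_vector \<Rightarrow> 'a \<Rightarrow> real) \<Rightarrow> 'a \<Rightarrow> 'a \<Rightarrow> 'a \<Rightarrow> real" where
  "ext_deriv \<alpha> q u v =
     frechet_derivative (\<lambda>r. \<alpha> r v) (at q) u - frechet_derivative (\<lambda>r. \<alpha> r u) (at q) v"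

definition reeb :: "'n::finite pt" where
  "reeb = (0, 0, 1)"

definition contact_ham_vf :: "('n::finite pt \<Rightarrow> real) \<Rightarrow> 'n pt \<Rightarrow> 'n pt" where
  "contact_ham_vf h q = (THE X.
     contact_form q X = h q \<and>
     (\<forall>v. ext_deriv contact_form q X v =
        - (frechet_derivative h (at q) v - frechet_derivative h (at q) reeb * contact_form q v)))"

definition legendre_submanifold ::
    "(real^'n::finite) set \<Rightarrow> (real^'n \<Rightarrow> real) \<Rightarrow> 'n pt set" where
  "legendre_submanifold U \<psi> = {(x, p, z). x \<in> U \<and> p = grad \<psi> x \<and> z = \<psi> x}"

definition integral_curve_in ::
    "'a::real_normed_vector set \<Rightarrow> ('a \<Rightarrow> 'a) \<Rightarrow> real set \<Rightarrow> (real \<Rightarrow> 'a) \<Rightarrow> bool" where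
  "integral_curve_in A X T \<gamma> \<longleftrightarrow>
     (\<forall>t\<in>T. \<gamma> t \<in> A \<and> (\<gamma> has_vector_derivative X (\<gamma> t)) (at t within T))"


subsection \<open>Dually flat structure, in the global chart \<open>x\<close> of the Legendre submanifold\<close>

text \<open>Vector fields on the chart domain \<open>U\<close> are given by total functions, of which only the
  values on \<open>U\<close> matter; a metric is given by its matrix of components.\<close>

definition riemannian_metric :: "(real^'n::finite) set \<Rightarrow> (real^'n \<Rightarrow> real^'n^'n) \<Rightarrow> bool" where
  "riemannian_metric U g \<longleftrightarrow> smooth_on g U \<and>
     (\<forall>x\<in>U. transpose (g x) = g x \<and> (\<forall>v. v \<noteq> 0 \<longrightarrow> v \<bullet> (g x *v v) > 0))"

text \<open>\<open>D X Y\<close> is the covariant derivative of \<open>Y\<close> along \<open>X\<close>.\<close>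

type_synonym 'n cov_deriv =
  "(real^'n \<Rightarrow> real^'n) \<Rightarrow> (real^'n \<Rightarrow> real^'n) \<Rightarrow> real^'n \<Rightarrow> real^'n"

definition affine_connection :: "(real^'n::finite) set \<Rightarrow> 'n cov_deriv \<Rightarrow> bool" where
  "affine_connection U D \<longleftrightarrow>
     (\<forall>X Y. smooth_on X U \<and> smooth_on Y U \<longrightarrow> smooth_on (D X Y) U) \<and>
     (\<forall>X X' Y. smooth_on X U \<and> smooth_on X' U \<and> smooth_on Y U \<longrightarrow>
        (\<forall>x\<in>U. D (\<lambda>y. X y + X' y) Y x = D X Y x + D X' Y x)) \<and>
     (\<forall>X Y Y'. smooth_on X U \<and> smooth_on Y U \<and> smooth_on Y' U \<longrightarrow>
        (\<forall>x\<in>U. D X (\<lambda>y. Y y + Y' y) x = D X Y x + D X Y' x)) \<and>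
     (\<forall>f X Y. smooth_on f U \<and> smooth_on X U \<and> smooth_on Y U \<longrightarrow>
        (\<forall>x\<in>U. D (\<lambda>y. f y *\<^sub>R X y) Y x = f x *\<^sub>R D X Y x)) \<and>
     (\<forall>f X Y. smooth_on f U \<and> smooth_on X U \<and> smooth_on Y U \<longrightarrow>
        (\<forall>x\<in>U. D X (\<lambda>y. f y *\<^sub>R Y y) x =
           frechet_derivative f (at x) (X x) *\<^sub>R Y x + f x *\<^sub>R D X Y x))"

text \<open>\<open>christoffel D a b x\<close> is the vector with components \<open>\<Gamma>\<^sub>a\<^sub>b\<^sup>c(x)\<close>, that is
  \<open>D\<^sub>a \<partial>\<^sub>b\<close> for the coordinate vector fields.\<close>

definition christoffel :: "'n::finite cov_deriv \<Rightarrow> 'n \<Rightarrow> 'n \<Rightarrow> real^'n \<Rightarrow> real^'n" where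
  "christoffel D a b x = D (\<lambda>_. axis a 1) (\<lambda>_. axis b 1) x"

definition dual_connections ::
    "(real^'n::finite) set \<Rightarrow> (real^'n \<Rightarrow> real^'n^'n) \<Rightarrow> 'n cov_deriv \<Rightarrow> 'n cov_deriv \<Rightarrow> bool" where
  "dual_connections U g D D' \<longleftrightarrow>
     (\<forall>X Y Z. smooth_on X U \<and> smooth_on Y U \<and> smooth_on Z U \<longrightarrow>
        (\<forall>x\<in>U. frechet_derivative (\<lambda>y. X y \<bullet> (g y *v Y y)) (at x) (Z x) =
           D Z X x \<bullet> (g x *v Y x) + X x \<bullet> (g x *v D' Z Y x)))"

text \<open>Affinely parametrised geodesics: \<open>v\<close> is the velocity and \<open>w\<close> the second derivative.\<close>

definition geodesic_on ::
    "(real^'n::finite) set \<Rightarrow> 'n cov_deriv \<Rightarrow> real set \<Rightarrow> (real \<Rightarrow> real^'n) \<Rightarrow> bool" where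
  "geodesic_on U D T c \<longleftrightarrow>
     (\<exists>v w. \<forall>t\<in>T. c t \<in> U \<and>
        (c has_vector_derivative v t) (at t within T) \<and>
        (v has_vector_derivative w t) (at t within T) \<and>
        w t + (\<Sum>a\<in>UNIV. \<Sum>b\<in>UNIV. (v t $ a * v t $ b) *\<^sub>R christoffel D a b (c t)) = 0)"

text \<open>A curve in the Legendre submanifold is a geodesic if its representation in the chart
  \<open>x\<close> is one.\<close>

definition geodesic_joining ::
    "(real^'n::finite) set \<Rightarrow> (real^'n \<Rightarrow> real) \<Rightarrow> 'n cov_deriv \<Rightarrow>
     'n pt \<Rightarrow> 'n pt \<Rightarrow> (real \<Rightarrow> 'n pt) \<Rightarrow> bool" where
  "geodesic_joining U \<psi> D q' q'' \<gamma> \<longleftrightarrow>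
     (\<forall>t\<in>{0..1}. \<gamma> t \<in> legendre_submanifold U \<psi>) \<and>
     geodesic_on U D {0..1} (\<lambda>t. fst (\<gamma> t)) \<and> \<gamma> 0 = q' \<and> \<gamma> 1 = q''"

end

theory Submission
  imports Defs
begin

text \<open>In the coordinates \<open>p = grad \<psi> x\<close>, which are injective on \<open>U\<close> because the Hessian of \<open>\<psi>\<close> is
  positive definite, the dual connection is flat: duality gives \<open>hess \<psi> (\<Gamma>\<^sup>*\<^sub>a\<^sub>b) = \<partial>\<^sub>a (hess \<psi>) e\<^sub>b\<close> for its
  coefficients, so the geodesic equation of a curve \<open>c\<close> says that \<open>hess \<psi> (c t) *v c' t\<close>, the
  velocity of \<open>grad \<psi> (c t)\<close>, is constant. The Hessian of the Legendre transform at \<open>grad \<psi> x\<close> is the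
  inverse of \<open>hess \<psi> x\<close>, so \<open>F\<close> is the vector field whose \<open>p\<close>-velocity is \<open>p'' - p'\<close>. On the Legendre
  submanifold both \<open>grad \<psi> x - p\<close> and \<open>\<psi> x - z\<close> vanish, which makes \<open>X\<^sub>h\<close> the lift of \<open>F\<close>: the terms
  with \<open>\<Gamma>' 0\<close> cancel because \<open>p = grad \<psi> x\<close>.\<close>

subsection \<open>Calculus of matrices and of partial derivatives\<close>

lemma bounded_bilinear_matrix_vector_mult:
  "bounded_bilinear ((*v) :: real^'n::finite^'m::finite \<Rightarrow> real^'n \<Rightarrow> real^'m)"
  unfolding bilinear_conv_bounded_bilinear[symmetric] bilinear_def
  by (auto intro!: linearI simp: matrix_vector_mult_add_rdistrib matrix_vector_right_distrib
      matrix_vector_mult_scaleR scaleR_matrix_vector_assoc)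

lemmas has_derivative_matrix_vector_mult [derivative_intros] =
  bounded_bilinear.FDERIV[OF bounded_bilinear_matrix_vector_mult]

lemma matrix_inverse_vector_cancel:
  fixes A B :: "real^'n::finite^'n"
  assumes "B ** A = mat 1"
  shows "B *v (A *v v) = v" "A *v (B *v v) = v"
proof -
  show "B *v (A *v v) = v"
    by (simp add: matrix_vector_mul_assoc assms)
  have "A ** B = mat 1"
    using assms by (simp add: matrix_left_right_inverse)
  then show "A *v (B *v v) = v"
    by (simp add: matrix_vector_mul_assoc)
qed

lemma matrix_inv_left:
  fixes A :: "real^'n::finite^'n"
  assumes "invertible A"
  shows "matrix_inv A ** A = mat 1"
  using assms someI_ex[of "\<lambda>A'. A ** A' = mat 1 \<and> A' ** A = mat 1"]
  by (simp add: invertible_def matrix_inv_def)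

text \<open>The map \<open>(x, k) \<mapsto> (x, B x *v k)\<close> is the inverse of \<open>(x, y) \<mapsto> (x, M x *v y)\<close>, so the
  derivative of the inverse function applies.\<close>

lemma has_derivative_inverse_matrix_vector_mult:
  fixes M B :: "real^'n::finite \<Rightarrow> real^'n^'n"
  assumes U: "open U" "x \<in> U"
    and M: "\<And>x. x \<in> U \<Longrightarrow> (M has_derivative M' x) (at x)"
    and B: "\<And>x. x \<in> U \<Longrightarrow> B x ** M x = mat 1"
  shows "((\<lambda>x. B x *v k) has_derivative (\<lambda>u. - (B x *v (M' x u *v (B x *v k))))) (at x)"
proof -
  let ?y = "B x *v k"
  let ?f = "\<lambda>(x, y). (x, M x *v y)" and ?g = "\<lambda>(x, k). (x, B x *v k)"
  let ?f' = "\<lambda>(x, y). \<lambda>(u, w). (u, M x *v w + M' x u *v y)"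
  let ?g' = "\<lambda>(u, l). (u, B x *v (l - M' x u *v ?y))"
  have f: "(?f has_derivative ?f' (a, y)) (at (a, y))" if "a \<in> U" for a y
  proof -
    have *: "((\<lambda>q. M (fst q)) has_derivative (\<lambda>q. M' a (fst q))) (at (a, y))"
      using diff_chain_at[of fst fst "(a, y)" M "M' a"] M[OF that]
      by (simp add: o_def has_derivative_fst[OF has_derivative_ident])
    have "((\<lambda>q. (fst q, M (fst q) *v snd q)) has_derivative
        (\<lambda>q. (fst q, M (fst (a, y)) *v snd q + M' a (fst q) *v snd (a, y)))) (at (a, y))"
      by (intro has_derivative_Pair has_derivative_fst has_derivative_snd has_derivative_ident
          has_derivative_matrix_vector_mult *)
    then show ?thesis
      by (simp add: case_prod_beta')
  qed
  have "(?g has_derivative ?g') (at (?f (x, ?y)))"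
  proof (rule has_derivative_inverse_strong[where S = "U \<times> UNIV" and f = ?f and x = "(x, ?y)"])
    show "open (U \<times> (UNIV :: (real^'n) set))" "(x, ?y) \<in> U \<times> UNIV"
      using U by (auto intro: open_Times)
    show "continuous_on (U \<times> UNIV) ?f"
      using f by (intro continuous_at_imp_continuous_on) (auto intro: has_derivative_continuous)
    show "?g (?f q) = q" if "q \<in> U \<times> UNIV" for q
      using that B by (auto simp: matrix_inverse_vector_cancel)
    show "(?f has_derivative ?f' (x, ?y)) (at (x, ?y))"
      by (rule f) fact
    show "?f' (x, ?y) \<circ> ?g' = id"
      using B[OF U(2)] by (auto simp: fun_eq_iff matrix_inverse_vector_cancel)
  qed
  \<comment> \<open>The base point is \<open>?f (x, ?y) = (x, k)\<close>. Fixing the second argument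
    at \<open>k\<close> and projecting to the second component then gives the claim.\<close>
  then have "(?g has_derivative ?g') (at (x, k))"
    using B[OF U(2)] by (simp add: matrix_inverse_vector_cancel)
  moreover have "((\<lambda>x. (x, k)) has_derivative (\<lambda>u. (u, 0))) (at x)"
    by (auto intro!: derivative_eq_intros)
  ultimately have "(?g \<circ> (\<lambda>x. (x, k)) has_derivative ?g' \<circ> (\<lambda>u. (u, 0))) (at x)"
    by (intro diff_chain_at)
  from has_derivative_snd[OF this] show ?thesis
    using linear_neg[OF matrix_vector_mul_linear[of "B x"]] by (simp add: o_def case_prod_beta)
qed

section \<open>Smooth functions, partial derivatives and gradients\<close>

lemma Ck_on_const: "Ck_on k (\<lambda>_. c) U"
proof (induction k arbitrary: c)
  case 0
  show ?case
    by (simp only: Ck_on.simps continuous_on_const)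
next
  case (Suc k)
  then show ?case
    by (simp only: Ck_on.simps frechet_derivative_const differentiable_on_const) blast
qed

text \<open>Coordinate vector fields are constant in the chart, so this admits them as test fields
  in \<open>dual_connections\<close>.\<close>

lemma smooth_on_const: "smooth_on (\<lambda>_. c) U"
  unfolding smooth_on_def by (blast intro: Ck_on_const)

lemma smooth_on_pd:
  fixes a :: "'n::finite"
  assumes "smooth_on f U"
  shows "smooth_on (pd a f) U"
proof -
  have "Ck_on k (\<lambda>x. frechet_derivative f (at x) (axis a 1)) U" for k
  proof -
    have "Ck_on (Suc k) f U"
      using assms unfolding smooth_on_def by blast
    moreover have "axis a 1 \<in> (Basis :: (real^'n) set)"
      by (simp add: axis_in_Basis_iff)
    ultimately show ?thesis
      by simp
  qed
  then show ?thesis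
    by (simp add: smooth_on_def pd_def[abs_def])
qed

lemma smooth_on_imp_differentiable:
  assumes "smooth_on f U" "open U" "x \<in> U"
  shows "f differentiable (at x)"
proof -
  have "Ck_on (Suc 0) f U"
    using assms(1) unfolding smooth_on_def by blast
  then have "f differentiable_on U"
    by simp
  with assms(2,3) show ?thesis
    by (simp add: differentiable_on_eq_differentiable_at)
qed

lemma linear_eq_sum_axis:
  fixes f :: "real^'n::finite \<Rightarrow> 'b::real_vector"
  assumes "linear f"
  shows "f v = (\<Sum>a\<in>UNIV. v $ a *\<^sub>R f (axis a 1))"
proof -
  have "f v = f (\<Sum>a\<in>UNIV. v $ a *\<^sub>R axis a 1)"
    by (subst basis_expansion[of v, symmetric]) (simp add: scalar_mult_eq_scaleR)
  then show ?thesis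
    by (simp add: linear_sum[OF assms] linear_cmul[OF assms])
qed

lemma has_derivative_grad:
  assumes "f differentiable (at x)"
  shows "(f has_derivative (\<lambda>v. grad f x \<bullet> v)) (at x)"
proof -
  have f: "(f has_derivative frechet_derivative f (at x)) (at x)"
    using assms frechet_derivative_works by blast
  have "frechet_derivative f (at x) v = grad f x \<bullet> v" for v
    using linear_eq_sum_axis[OF has_derivative_linear[OF f], of v]
    by (simp add: grad_def pd_def inner_vec_def mult.commute)
  then have "frechet_derivative f (at x) = (\<bullet>) (grad f x)"
    by (rule ext)
  with f show ?thesis
    by simp
qed

lemma pd_eq_if_has_derivative:
  "(f has_derivative f') (at x) \<Longrightarrow> pd a f x = f' (axis a 1)"
  using frechet_derivative_at[of f f' x] by (simp add: pd_def)

lemma has_derivative_vecI: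
  fixes f :: "'a::euclidean_space \<Rightarrow> 'b::euclidean_space^'n::finite"
  assumes "\<And>i. ((\<lambda>x. f x $ i) has_derivative (\<lambda>v. f' v $ i)) (at x within S)"
  shows "(f has_derivative f') (at x within S)"
proof (rule has_derivative_componentwise_within[THEN iffD2], rule ballI)
  fix j :: "'b^'n" assume "j \<in> Basis"
  then obtain i u where j: "j = axis i u"
    by (auto simp: Basis_vec_def)
  show "((\<lambda>x. f x \<bullet> j) has_derivative (\<lambda>x. f' x \<bullet> j)) (at x within S)"
    unfolding j inner_axis by (intro has_derivative_inner_left assms)
qed

lemma differentiable_vecI:
  fixes f :: "'a::euclidean_space \<Rightarrow> 'b::euclidean_space^'n::finite"
  assumes "\<And>i. (\<lambda>x. f x $ i) differentiable (at x within S)"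
  shows "f differentiable (at x within S)"
proof -
  let ?D = "\<lambda>v. \<chi> i. frechet_derivative (\<lambda>x. f x $ i) (at x within S) v"
  have "((\<lambda>x. f x $ i) has_derivative (\<lambda>v. ?D v $ i)) (at x within S)" for i
    using assms[of i] unfolding frechet_derivative_works by simp
  then have "(f has_derivative ?D) (at x within S)"
    by (rule has_derivative_vecI)
  then show ?thesis
    by (rule differentiableI)
qed

lemma has_vector_derivative_has_derivative_compose:
  assumes c: "(c has_vector_derivative v) (at t within T)" and f: "(f has_derivative f') (at (c t))"
  shows "((\<lambda>t. f (c t)) has_vector_derivative f' v) (at t within T)"
  using has_derivative_compose[OF c[unfolded has_vector_derivative_def] f]
  by (simp add: has_vector_derivative_def linear_cmul[OF has_derivative_linear[OF f]])

text \<open>Used to see that the chart domain \<open>U\<close>, given as the projection of the open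
  set \<open>C\<close>, is open.\<close>

lemma open_fst_image:
  fixes C :: "('a::topological_space \<times> 'b::topological_space) set"
  assumes "open C"
  shows "open (fst ` C)"
  unfolding open_subopen[of "fst ` C"]
proof
  fix x assume "x \<in> fst ` C"
  then obtain y where "(x, y) \<in> C"
    by auto
  with assms obtain A B where "open A" "open B" "(x, y) \<in> A \<times> B" "A \<times> B \<subseteq> C"
    by (metis open_prod_elim)
  then show "\<exists>T. open T \<and> x \<in> T \<and> T \<subseteq> fst ` C"
    by (intro exI[of _ A]) force
qed

subsection \<open>Contact Hamiltonian vector fields\<close>

text \<open>On a fixed vector \<open>(u, w, s)\<close> the contact form is a constant minus
  \<open>p \<bullet> u\<close>; antisymmetrising its derivative yields the two-form dx^a wedge
  dp_a.\<close>

lemma ext_deriv_contact_form: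
  fixes q :: "'n::finite pt"
  shows "ext_deriv contact_form q (X, P, Z) (u, w, s) = w \<bullet> X - P \<bullet> u"
proof -
  have *: "((\<lambda>r. s - fst (snd r) \<bullet> u) has_derivative (\<lambda>r. 0 - fst (snd r) \<bullet> u)) (at q)"
    for u :: "real^'n" and s
    by (intro has_derivative_diff has_derivative_const has_derivative_inner_left has_derivative_fst
        has_derivative_snd has_derivative_ident)
  then have "frechet_derivative (\<lambda>r. contact_form r (u, w, s)) (at q) = (\<lambda>r. - (fst (snd r) \<bullet> u))"
    for u w :: "real^'n" and s
    using frechet_derivative_at[OF *[of s u]] by (simp add: contact_form_def case_prod_beta')
  then show ?thesis
    by (simp add: ext_deriv_def)
qed

text \<open>Here \<open>P\<close> is dh/dx, \<open>- X\<close> is dh/dp and \<open>c\<close> is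
  dh/dz, so this is the usual coordinate form of the field. The definition by \<open>THE\<close>
  also calls for uniqueness: the two-form determines the x- and p-components, and the contact form
  then fixes the z-component.\<close>

lemma contact_ham_vf_eq:
  fixes x p P X :: "real^'n::finite"
  assumes dh: "(h has_derivative (\<lambda>(u, w, s). P \<bullet> u - X \<bullet> w + c * s)) (at (x, p, z))"
  shows "contact_ham_vf h (x, p, z) = (X, P + c *\<^sub>R p, h (x, p, z) + p \<bullet> X)"
proof -
  let ?is_X = "\<lambda>Y. contact_form (x, p, z) Y = h (x, p, z) \<and>
     (\<forall>v. ext_deriv contact_form (x, p, z) Y v =
        - (frechet_derivative h (at (x, p, z)) v -
           frechet_derivative h (at (x, p, z)) reeb * contact_form (x, p, z) v))"
  have dh': "frechet_derivative h (at (x, p, z)) = (\<lambda>(u, w, s). P \<bullet> u - X \<bullet> w + c * s)"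
    using frechet_derivative_at[OF dh] by simp
  \<comment> \<open>The \<open>s\<close> terms cancel, since dh - (Rh) lambda vanishes on the Reeb
    direction.\<close>
  have is_X: "?is_X (Y1, Y2, Y3) \<longleftrightarrow> Y3 = h (x, p, z) + p \<bullet> Y1 \<and>
      (\<forall>u w. w \<bullet> Y1 - Y2 \<bullet> u = X \<bullet> w - (P + c *\<^sub>R p) \<bullet> u)" for Y1 Y2 Y3
    unfolding split_paired_All ext_deriv_contact_form dh'
    by (auto simp: contact_form_def reeb_def inner_add_left algebra_simps)
  show ?thesis
    unfolding contact_ham_vf_def
  proof (rule the_equality)
    show "?is_X (X, P + c *\<^sub>R p, h (x, p, z) + p \<bullet> X)"
      unfolding is_X by (simp add: inner_commute)
  next
    fix Y assume "?is_X Y"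
    moreover obtain Y1 Y2 Y3 where Y: "Y = (Y1, Y2, Y3)"
      by (metis prod.collapse)
    ultimately have Y3: "Y3 = h (x, p, z) + p \<bullet> Y1"
      and eq: "\<And>u w. w \<bullet> Y1 - Y2 \<bullet> u = X \<bullet> w - (P + c *\<^sub>R p) \<bullet> u"
      using is_X by blast+
    have "\<forall>w. w \<bullet> Y1 = w \<bullet> X"
      using eq[of _ 0] by (simp add: inner_commute)
    moreover have "\<forall>u. Y2 \<bullet> u = (P + c *\<^sub>R p) \<bullet> u"
      using eq[of 0] by simp
    ultimately show "Y = (X, P + c *\<^sub>R p, h (x, p, z) + p \<bullet> X)"
      unfolding vector_eq_rdot vector_eq_ldot using Y Y3 by simp
  qed
qed

subsection \<open>Potentials with positive definite Hessian\<close>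

text \<open>Positive definiteness makes \<open>grad \<psi>\<close> strictly monotone; convexity of
  \<open>U\<close> keeps the segments used in mean value arguments inside the chart.\<close>

locale hessian_potential =
  fixes U :: "(real^'n::finite) set" and \<psi> :: "real^'n \<Rightarrow> real"
  assumes open_U: "open U" and convex_U: "convex U"
    and smooth: "smooth_on \<psi> U" and metric: "riemannian_metric U (hess \<psi>)"
begin

lemma potential_has_derivative:
  "x \<in> U \<Longrightarrow> (\<psi> has_derivative (\<lambda>v. grad \<psi> x \<bullet> v)) (at x)"
  by (intro has_derivative_grad smooth_on_imp_differentiable[OF smooth open_U])

lemma hess_sym: "x \<in> U \<Longrightarrow> transpose (hess \<psi> x) = hess \<psi> x"
  and hess_pos: "x \<in> U \<Longrightarrow> v \<noteq> 0 \<Longrightarrow> v \<bullet> (hess \<psi> x *v v) > 0"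
  using metric by (auto simp: riemannian_metric_def)

lemma grad_has_derivative:
  assumes "x \<in> U"
  shows "(grad \<psi> has_derivative (*v) (hess \<psi> x)) (at x)"
proof (rule has_derivative_vecI)
  fix b
  \<comment> \<open>By the index order in \<open>hess\<close>, the gradient of
    \<open>pd b \<psi>\<close> is column \<open>b\<close> of the Hessian; symmetry of the metric
    turns it into row \<open>b\<close>.\<close>
  have "grad (pd b \<psi>) x \<bullet> v = (hess \<psi> x *v v) $ b" for v
  proof -
    have "grad (pd b \<psi>) x \<bullet> v = (transpose (hess \<psi> x) *v v) $ b"
      by (simp add: grad_def hess_def transpose_def matrix_vector_mult_def inner_vec_def
          del: transpose_matrix_vector)
    then show ?thesis
      using hess_sym[OF assms] by simp
  qed
  moreover have "(pd b \<psi> has_derivative (\<lambda>v. grad (pd b \<psi>) x \<bullet> v)) (at x)"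
    by (intro has_derivative_grad smooth_on_imp_differentiable[OF smooth_on_pd[OF smooth] open_U] assms)
  ultimately show "((\<lambda>x. grad \<psi> x $ b) has_derivative (\<lambda>v. (hess \<psi> x *v v) $ b)) (at x)"
    by (simp add: grad_def)
qed

lemma hess_has_derivative:
  assumes "x \<in> U"
  shows "(hess \<psi> has_derivative frechet_derivative (hess \<psi>) (at x)) (at x)"
proof -
  have "hess \<psi> differentiable (at x)"
  proof (rule differentiable_vecI, rule differentiable_vecI)
    fix a b
    have "pd a (pd b \<psi>) differentiable (at x)"
      by (intro smooth_on_imp_differentiable[OF _ open_U assms] smooth_on_pd smooth)
    then show "(\<lambda>x. hess \<psi> x $ a $ b) differentiable (at x)"
      by (simp add: hess_def)
  qed
  then show ?thesis
    using frechet_derivative_works by blast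
qed

lemma segment_in_U:
  assumes "x \<in> U" "y \<in> U" "0 \<le> t" "t \<le> 1"
  shows "x + t *\<^sub>R (y - x) \<in> U"
  using convexD_alt[OF convex_U assms] by (simp add: algebra_simps)

text \<open>Along the segment the derivative of the slope in direction \<open>y - x\<close> is the
  Hessian quadratic form of \<open>y - x\<close>, which is positive; the mean value theorem
  concludes.\<close>

lemma grad_strict_mono:
  assumes "x \<in> U" "y \<in> U" "x \<noteq> y"
  shows "(grad \<psi> y - grad \<psi> x) \<bullet> (y - x) > 0"
proof -
  let ?c = "\<lambda>t. x + t *\<^sub>R (y - x)"
  have "((\<lambda>t. grad \<psi> (?c t) \<bullet> (y - x)) has_derivative
      (\<lambda>s. (hess \<psi> (?c t) *v (s *\<^sub>R (y - x))) \<bullet> (y - x))) (at t within {0..1})"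
    if "0 \<le> t" "t \<le> 1" for t
  proof -
    have "(?c has_derivative (\<lambda>s. s *\<^sub>R (y - x))) (at t within {0..1})"
      by (auto intro!: derivative_eq_intros)
    from has_derivative_compose[OF this grad_has_derivative[OF segment_in_U[OF assms(1,2) that]]]
    show ?thesis
      by (rule has_derivative_inner_left)
  qed
  from mvt_simple[OF zero_less_one this] obtain t where t: "0 < t" "t < 1"
    and "grad \<psi> (?c 1) \<bullet> (y - x) - grad \<psi> (?c 0) \<bullet> (y - x)
      = (hess \<psi> (?c t) *v ((1 - 0) *\<^sub>R (y - x))) \<bullet> (y - x)"
    by auto
  then have "(grad \<psi> y - grad \<psi> x) \<bullet> (y - x) = (y - x) \<bullet> (hess \<psi> (?c t) *v (y - x))"
    by (simp only: inner_diff_left[symmetric] inner_commute[of "y - x"]) simp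
  then show ?thesis
    using hess_pos[OF segment_in_U[OF assms(1,2)], of t "y - x"] t assms(3) by simp
qed

text \<open>The increment of \<open>\<psi>\<close> is the slope at an interior point of the segment,
  which exceeds the slope at \<open>x\<close> by \<open>grad_strict_mono\<close>.\<close>

lemma above_tangent_strict:
  assumes "x \<in> U" "y \<in> U" "x \<noteq> y"
  shows "\<psi> x + grad \<psi> x \<bullet> (y - x) < \<psi> y"
proof -
  let ?c = "\<lambda>t. x + t *\<^sub>R (y - x)"
  have "((\<lambda>t. \<psi> (?c t)) has_derivative (\<lambda>s. grad \<psi> (?c t) \<bullet> (s *\<^sub>R (y - x)))) (at t within {0..1})"
    if "0 \<le> t" "t \<le> 1" for t
  proof -
    have "(?c has_derivative (\<lambda>s. s *\<^sub>R (y - x))) (at t within {0..1})"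
      by (auto intro!: derivative_eq_intros)
    from has_derivative_compose[OF this potential_has_derivative[OF segment_in_U[OF assms(1,2) that]]]
    show ?thesis .
  qed
  from mvt_simple[OF zero_less_one this] obtain t where t: "0 < t" "t < 1"
    and eq: "\<psi> y - \<psi> x = grad \<psi> (?c t) \<bullet> (y - x)"
    by auto
  have "(grad \<psi> (?c t) - grad \<psi> x) \<bullet> (?c t - x) > 0"
    using t assms by (intro grad_strict_mono segment_in_U) auto
  then have "t * ((grad \<psi> (?c t) - grad \<psi> x) \<bullet> (y - x)) > 0"
    by simp
  then have "(grad \<psi> (?c t) - grad \<psi> x) \<bullet> (y - x) > 0"
    using t by (simp add: zero_less_mult_iff)
  then show ?thesis
    using eq by (simp add: inner_diff_left)
qed

lemma above_tangent:
  "x \<in> U \<Longrightarrow> y \<in> U \<Longrightarrow> \<psi> x + grad \<psi> x \<bullet> (y - x) \<le> \<psi> y"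
  using above_tangent_strict[of x y] by (cases "x = y") auto

section \<open>The gradient map as a change of coordinates, and the Legendre transform\<close>

lemma inj_on_grad: "inj_on (grad \<psi>) U"
proof (rule inj_onI, rule ccontr)
  fix x y assume "x \<in> U" "y \<in> U" "grad \<psi> x = grad \<psi> y" "x \<noteq> y"
  then show False
    using grad_strict_mono[of x y] by simp
qed

lemma continuous_on_grad: "continuous_on U (grad \<psi>)"
  using grad_has_derivative by (intro continuous_at_imp_continuous_on) (blast intro: has_derivative_continuous)

text \<open>Openness allows identities that hold on the image to be differentiated in the
  coordinates p.\<close>

lemma open_grad_image: "open (grad \<psi> ` U)"
  by (intro invariance_of_domain continuous_on_grad open_U inj_on_grad)

text \<open>The tangent at \<open>x\<close> supports the graph of \<open>\<psi>\<close> from below,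
  so the supremum is attained at \<open>x\<close>.\<close>

lemma legendre_transform_grad:
  assumes "x \<in> U"
  shows "legendre_transform U \<psi> (grad \<psi> x) = x \<bullet> grad \<psi> x - \<psi> x"
  unfolding legendre_transform_def
proof (rule cSup_eq_maximum)
  show "x \<bullet> grad \<psi> x - \<psi> x \<in> (\<lambda>y. y \<bullet> grad \<psi> x - \<psi> y) ` U"
    using assms by blast
  show "z \<le> x \<bullet> grad \<psi> x - \<psi> x" if "z \<in> (\<lambda>y. y \<bullet> grad \<psi> x - \<psi> y) ` U" for z
    using that above_tangent[OF assms] by (fastforce simp: inner_diff_right inner_commute)
qed

lemma matrix_inv_hess:
  assumes "x \<in> U"
  shows "matrix_inv (hess \<psi> x) ** hess \<psi> x = mat 1"
proof -
  have "inj ((*v) (hess \<psi> x))"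
    unfolding vec.inj_iff_eq_0 using hess_pos[OF assms] by force
  then have "invertible (hess \<psi> x)"
    by (simp add: invertible_left_inverse matrix_left_invertible_injective)
  then show ?thesis
    by (rule matrix_inv_left)
qed

text \<open>The coordinates x as functions of p, meaningful on the image of \<open>U\<close> under
  \<open>grad \<psi>\<close>.\<close>

definition grad_inv :: "real^'n \<Rightarrow> real^'n" where
  "grad_inv = the_inv_into U (grad \<psi>)"

lemma grad_inv_grad [simp]: "x \<in> U \<Longrightarrow> grad_inv (grad \<psi> x) = x"
  unfolding grad_inv_def by (rule the_inv_into_f_f[OF inj_on_grad])

lemma grad_inv_has_derivative:
  assumes "x \<in> U"
  shows "(grad_inv has_derivative (*v) (matrix_inv (hess \<psi> x))) (at (grad \<psi> x))"
proof (rule has_derivative_inverse_strong[OF open_U assms continuous_on_grad])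
  show "(grad \<psi> has_derivative (*v) (hess \<psi> x)) (at x)"
    by (rule grad_has_derivative[OF assms])
  show "(*v) (hess \<psi> x) \<circ> (*v) (matrix_inv (hess \<psi> x)) = id"
    by (simp add: fun_eq_iff matrix_inverse_vector_cancel[OF matrix_inv_hess[OF assms]])
qed simp

text \<open>On the image of the gradient the transform is
  \<open>grad_inv p \<bullet> p - \<psi> (grad_inv p)\<close>. The two terms with the derivative of
  \<open>grad_inv\<close> cancel, which leaves \<open>grad_inv\<close> as the gradient of the
  transform.\<close>

lemma legendre_transform_has_derivative:
  assumes "x \<in> U"
  shows "(legendre_transform U \<psi> has_derivative (\<lambda>v. x \<bullet> v)) (at (grad \<psi> x))"
proof (rule has_derivative_transform_within_open[OF _ open_grad_image])
  let ?p = "grad \<psi> x" and ?B = "(*v) (matrix_inv (hess \<psi> x))"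
  have 1: "((\<lambda>p. \<psi> (grad_inv p)) has_derivative (\<lambda>v. ?p \<bullet> ?B v)) (at ?p)"
    using has_derivative_compose[OF grad_inv_has_derivative[OF assms], of \<psi> "\<lambda>v. ?p \<bullet> v"]
      potential_has_derivative[OF assms] assms by simp
  have 2: "((\<lambda>p. grad_inv p \<bullet> p) has_derivative (\<lambda>v. grad_inv ?p \<bullet> v + ?B v \<bullet> ?p)) (at ?p)"
    by (rule has_derivative_inner[OF grad_inv_has_derivative[OF assms] has_derivative_ident])
  show "((\<lambda>p. grad_inv p \<bullet> p - \<psi> (grad_inv p)) has_derivative (\<lambda>v. x \<bullet> v)) (at ?p)"
    using has_derivative_diff[OF 2 1] assms by (simp add: inner_commute)
qed (use assms in \<open>auto simp: legendre_transform_grad\<close>)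

text \<open>The gradient of the transform is \<open>grad_inv\<close>, whose derivative is the
  inverse Hessian.\<close>

lemma hess_legendre_transform:
  assumes "x \<in> U"
  shows "hess (legendre_transform U \<psi>) (grad \<psi> x) = matrix_inv (hess \<psi> x)"
proof -
  let ?\<phi> = "legendre_transform U \<psi>" and ?p = "grad \<psi> x" and ?B = "matrix_inv (hess \<psi> x)"
  have "(pd b ?\<phi> has_derivative (\<lambda>v. (?B *v v) $ b)) (at ?p)" for b
  proof (rule has_derivative_transform_within_open[OF _ open_grad_image])
    show "((\<lambda>p. grad_inv p $ b) has_derivative (\<lambda>v. (?B *v v) $ b)) (at ?p)"
      by (rule bounded_linear.has_derivative[OF bounded_linear_vec_nth grad_inv_has_derivative[OF assms]])
    show "grad_inv p $ b = pd b ?\<phi> p" if "p \<in> grad \<psi> ` U" for p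
      using that pd_eq_if_has_derivative[OF legendre_transform_has_derivative]
      by (auto simp: inner_axis)
  qed (use assms in auto)
  then have "pd a (pd b ?\<phi>) ?p = ?B $ b $ a" for a b
    by (rule pd_eq_if_has_derivative[THEN trans]) (simp add: matrix_vector_mult_basis column_def)
  then have "hess ?\<phi> ?p = transpose ?B"
    by (simp add: hess_def[of ?\<phi>] transpose_def)
  \<comment> \<open>The index order in \<open>hess\<close> produced a transpose; it equals
    \<open>?B\<close> because both are inverse to the symmetric matrix
    \<open>hess \<psi> x\<close>.\<close>
  moreover have HB: "hess \<psi> x ** ?B = mat 1"
    using matrix_inv_hess[OF assms] by (simp add: matrix_left_right_inverse)
  then have "transpose ?B ** hess \<psi> x = mat 1"
    by (metis hess_sym[OF assms] matrix_transpose_mul transpose_mat)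
  then have "transpose ?B = ?B"
    using HB by (metis matrix_mul_assoc matrix_mul_lid matrix_mul_rid)
  ultimately show ?thesis
    by simp
qed

text \<open>A convex combination of \<open>grad \<psi> x1\<close> and \<open>grad \<psi> x2\<close> is the gradient of \<open>\<psi>\<close> at a minimiser
  of \<open>u * f1 + v * f2\<close>; a minimiser exists because \<open>f1\<close> grows linearly away from its strict
  minimiser \<open>x1\<close> and \<open>f2\<close> is bounded below.\<close>

lemma convex_grad_image:
  assumes U: "U = UNIV"
  shows "convex (grad \<psi> ` U)"
proof (rule convexI)
  fix p1 p2 and u v :: real
  assume "p1 \<in> grad \<psi> ` U" "p2 \<in> grad \<psi> ` U" and uv: "0 \<le> u" "0 \<le> v" "u + v = 1"
  then obtain x1 x2 where x: "p1 = grad \<psi> x1" "p2 = grad \<psi> x2"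
    by blast
  show "u *\<^sub>R p1 + v *\<^sub>R p2 \<in> grad \<psi> ` U"
  \<comment> \<open>Growth at infinity will come from \<open>f1\<close>, so its weight
    \<open>u\<close> has to be positive.\<close>
  proof (cases "u = 0")
    case True
    then show ?thesis
      using uv \<open>p2 \<in> _\<close> by simp
  next
    case False
    with uv have u: "u > 0"
      by simp
    \<comment> \<open>The tilts make \<open>x1\<close> and \<open>x2\<close> critical points of
      \<open>f1\<close> and \<open>f2\<close>. As \<open>u + v = 1\<close>, the gradient of
      \<open>f\<close> is \<open>grad \<psi> y - (u *\<^sub>R p1 + v *\<^sub>R p2)\<close>.\<close>
    define f1 f2 f where "f1 y = \<psi> y - p1 \<bullet> y" and "f2 y = \<psi> y - p2 \<bullet> y"
      and "f y = u * f1 y + v * f2 y" for y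
    have deriv: "(f has_derivative (\<lambda>w. u * (grad \<psi> y \<bullet> w - p1 \<bullet> w) + v * (grad \<psi> y \<bullet> w - p2 \<bullet> w))) (at y)" for y
      unfolding f_def f1_def f2_def
      by (intro has_derivative_add has_derivative_mult_right has_derivative_diff has_derivative_inner_right
          has_derivative_ident potential_has_derivative) (simp_all add: U)
    have cont: "continuous_on S f1" "continuous_on S f" for S
    proof -
      have "continuous_on S \<psi>"
        using potential_has_derivative U
        by (intro continuous_at_imp_continuous_on) (blast intro: has_derivative_continuous)
      then show "continuous_on S f1" "continuous_on S f"
        unfolding f_def f1_def f2_def by (intro continuous_intros; assumption)+
    qed
    have f2: "f2 x2 \<le> f2 y" for y
      using above_tangent[of x2 y] U by (simp add: f2_def x inner_diff_right)
    \<comment> \<open>A basis vector exists, so the unit sphere around \<open>x1\<close> is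
      nonempty, and \<open>f1\<close> has a minimum on it by compactness.\<close>
    have "\<exists>i. i \<in> (Basis :: (real^'n) set)"
      using nonempty_Basis by blast
    then obtain y0 where y0: "dist x1 y0 = 1" and min: "\<And>y. dist x1 y = 1 \<Longrightarrow> f1 y0 \<le> f1 y"
      using continuous_attains_inf[of "sphere x1 1" f1] cont by auto
    define \<mu> where "\<mu> = f1 y0 - f1 x1"
    have "\<mu> > 0"
    proof -
      have "x1 \<noteq> y0"
        using y0 by auto
      then show ?thesis
        using above_tangent_strict[of x1 y0] U by (simp add: \<mu>_def f1_def x inner_diff_right)
    qed
    \<comment> \<open>The ray from \<open>x1\<close> to \<open>y\<close> meets the unit sphere at
      \<open>z\<close>, where \<open>f1\<close> has risen by at least \<open>\<mu>\<close>; by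
      convexity it keeps rising at least at that rate.\<close>
    have growth: "f1 x1 + dist x1 y * \<mu> \<le> f1 y" if "dist x1 y \<ge> 1" for y
    proof -
      define r z where "r = dist x1 y" and "z = x1 + (1 / r) *\<^sub>R (y - x1)"
      have r: "r \<ge> 1" "y - x1 = r *\<^sub>R (z - x1)"
        using that by (auto simp: r_def z_def)
      then have yz: "y - z = (r - 1) *\<^sub>R (z - x1)"
        by (simp add: algebra_simps)
      have "dist x1 z = 1"
        using that by (auto simp: z_def r_def dist_norm norm_minus_commute)
      then have "f1 x1 + \<mu> \<le> f1 z"
        using min by (simp add: \<mu>_def)
      then have "r * (f1 x1 + \<mu>) \<le> r * f1 z"
        using r by (simp add: mult_left_mono)
      moreover have "r * f1 z \<le> f1 y + (r - 1) * f1 x1"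
      proof -
        \<comment> \<open>This is the radial derivative of \<open>f1\<close> at \<open>z\<close>.
          The tangent at \<open>z\<close> bounds \<open>f1\<close> below at both \<open>y\<close>
          and \<open>x1\<close>, and \<open>?w\<close> is eliminated between the two bounds.\<close>
        let ?w = "(grad \<psi> z - p1) \<bullet> (z - x1)"
        have "f1 z + (r - 1) * ?w \<le> f1 y"
        proof -
          have "f1 z + (grad \<psi> z - p1) \<bullet> (y - z) \<le> f1 y"
            using above_tangent[of z y] U by (simp add: f1_def inner_diff_left inner_diff_right)
          then show ?thesis
            by (simp add: yz)
        qed
        moreover have "f1 z - ?w \<le> f1 x1"
          using above_tangent[of z x1] U by (simp add: f1_def inner_diff_left inner_diff_right)
        then have "(r - 1) * (f1 z - ?w) \<le> (r - 1) * f1 x1"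
          using r by (intro mult_left_mono) auto
        ultimately show ?thesis
          by (simp add: algebra_simps)
      qed
      ultimately show ?thesis
        by (simp add: r_def[symmetric] algebra_simps)
    qed
    \<comment> \<open>The quotient solves \<open>u * (f1 x1 + R * \<mu>) + v * f2 x2 = f x1\<close>
      for \<open>R\<close>; the maximum with 1 brings points beyond \<open>R\<close> into the range
      of \<open>growth\<close>.\<close>
    define R where "R = max 1 ((f x1 - u * f1 x1 - v * f2 x2) / (u * \<mu>))"
    have outside: "f x1 \<le> f y" if "dist x1 y \<ge> R" for y
    proof -
      have "f x1 - u * f1 x1 - v * f2 x2 \<le> dist x1 y * (u * \<mu>)"
        using that u \<open>\<mu> > 0\<close> by (simp add: R_def pos_divide_le_eq[symmetric])
      moreover have "u * (f1 x1 + dist x1 y * \<mu>) \<le> u * f1 y"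
        using that u growth by (simp add: R_def)
      moreover have "v * f2 x2 \<le> v * f2 y"
        using uv f2 by (simp add: mult_left_mono)
      ultimately show ?thesis
        unfolding f_def by (simp add: algebra_simps)
    qed
    have "R \<ge> 1"
      by (simp add: R_def)
    then obtain y where "dist x1 y \<le> R" and y_min: "\<And>z. dist x1 z \<le> R \<Longrightarrow> f y \<le> f z"
      using continuous_attains_inf[of "cball x1 R" f] cont by auto
    \<comment> \<open>The ball contains \<open>x1\<close>, and outside it \<open>f\<close> is at
      least \<open>f x1\<close>, so the minimum over the ball is global.\<close>
    have "f y \<le> f z" for z
    proof (cases "dist x1 z \<le> R")
      case False
      then have "f x1 \<le> f z"
        by (intro outside) simp
      moreover have "f y \<le> f x1"
        using \<open>R \<ge> 1\<close> by (intro y_min) simp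
      ultimately show ?thesis
        by simp
    qed (rule y_min)
    then have zero: "(\<lambda>w. u * (grad \<psi> y \<bullet> w - p1 \<bullet> w) + v * (grad \<psi> y \<bullet> w - p2 \<bullet> w)) = (\<lambda>w. 0)"
      by (intro differential_zero_maxmin[OF UNIV_I open_UNIV deriv]) simp
    have "grad \<psi> y \<bullet> w = (u *\<^sub>R p1 + v *\<^sub>R p2) \<bullet> w" for w
    proof -
      have "grad \<psi> y \<bullet> w = (u + v) * (grad \<psi> y \<bullet> w)"
        using uv by simp
      moreover have "u * (grad \<psi> y \<bullet> w - p1 \<bullet> w) + v * (grad \<psi> y \<bullet> w - p2 \<bullet> w) = 0"
        by (rule fun_cong[OF zero])
      ultimately show ?thesis
        by (simp add: algebra_simps)
    qed
    then have "grad \<psi> y = u *\<^sub>R p1 + v *\<^sub>R p2"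
      using vector_eq_rdot[of "grad \<psi> y" "u *\<^sub>R p1 + v *\<^sub>R p2"] by simp
    moreover have "grad \<psi> y \<in> grad \<psi> ` U"
      by (simp add: U)
    ultimately show ?thesis
      by simp
  qed
qed

subsection \<open>Dual geodesics\<close>

text \<open>Duality is applied to three coordinate fields. The \<open>D\<close> term vanishes with
  its coefficients, so the dual coefficient with lowered index is the partial derivative of the
  metric component.\<close>

lemma hess_christoffel_dual:
  assumes dual: "dual_connections U (hess \<psi>) D D'"
    and D: "\<forall>a b. \<forall>x\<in>U. christoffel D a b x = 0" and x: "x \<in> U"
  shows "hess \<psi> x *v christoffel D' a b x = frechet_derivative (hess \<psi>) (at x) (axis a 1) *v axis b 1"
    (is "?l = ?H (axis a 1) *v axis b 1")
proof (rule vec_eq_iff[THEN iffD2], rule allI)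
  fix c
  have "((\<lambda>y. axis c 1 \<bullet> (hess \<psi> y *v axis b 1)) has_derivative
      (\<lambda>u. axis c 1 \<bullet> (hess \<psi> x *v 0 + ?H u *v axis b 1))) (at x)"
    by (intro has_derivative_inner_right has_derivative_matrix_vector_mult hess_has_derivative
        has_derivative_const x)
  then have "frechet_derivative (\<lambda>y. axis c 1 \<bullet> (hess \<psi> y *v axis b 1)) (at x) (axis a 1)
      = axis c 1 \<bullet> (?H (axis a 1) *v axis b 1)"
    by (subst frechet_derivative_at[symmetric]) auto
  moreover have "frechet_derivative (\<lambda>y. axis c 1 \<bullet> (hess \<psi> y *v axis b 1)) (at x) (axis a 1)
      = christoffel D a c x \<bullet> (hess \<psi> x *v axis b 1) + axis c 1 \<bullet> ?l"
    using dual[unfolded dual_connections_def, rule_format,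
        of "\<lambda>_. axis c 1" "\<lambda>_. axis b 1" "\<lambda>_. axis a 1" x] x
    by (simp add: smooth_on_const christoffel_def)
  ultimately show "?l $ c = (?H (axis a 1) *v axis b 1) $ c"
    using D x by (simp add: inner_axis')
qed

text \<open>Expanding both occurrences of \<open>v\<close> in the basis gives the contraction that
  appears in the geodesic equation.\<close>

lemma hess_christoffel_dual_sum:
  assumes dual: "dual_connections U (hess \<psi>) D D'"
    and D: "\<forall>a b. \<forall>x\<in>U. christoffel D a b x = 0" and x: "x \<in> U"
  shows "hess \<psi> x *v (\<Sum>a\<in>UNIV. \<Sum>b\<in>UNIV. (v $ a * v $ b) *\<^sub>R christoffel D' a b x)
    = frechet_derivative (hess \<psi>) (at x) v *v v" (is "_ = ?H v *v v")
proof -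
  have "linear (\<lambda>u. ?H u *v v)"
    by (intro bounded_linear.linear bounded_linear_compose[OF
          bounded_bilinear.bounded_linear_left[OF bounded_bilinear_matrix_vector_mult]
          has_derivative_bounded_linear[OF hess_has_derivative[OF x]]])
  then have "?H v *v v = (\<Sum>a\<in>UNIV. v $ a *\<^sub>R (?H (axis a 1) *v v))"
    by (rule linear_eq_sum_axis)
  also have "\<dots> = (\<Sum>a\<in>UNIV. v $ a *\<^sub>R (\<Sum>b\<in>UNIV. v $ b *\<^sub>R (?H (axis a 1) *v axis b 1)))"
    by (subst linear_eq_sum_axis[OF matrix_vector_mul_linear, of _ v]) simp
  also have "\<dots> = (\<Sum>a\<in>UNIV. \<Sum>b\<in>UNIV. (v $ a * v $ b) *\<^sub>R (hess \<psi> x *v christoffel D' a b x))"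
    by (simp add: hess_christoffel_dual[OF dual D x] scaleR_sum_right)
  finally show ?thesis
    by (simp add: linear_sum[OF matrix_vector_mul_linear] linear_cmul[OF matrix_vector_mul_linear])
qed

text \<open>Since \<open>hess \<psi> (c t) *v c' t\<close> is the velocity in the affine coordinates \<open>p = grad \<psi> x\<close>, both
  sides say that this velocity is the constant \<open>k\<close>.\<close>

lemma dual_geodesic_on_iff:
  assumes dual: "dual_connections U (hess \<psi>) D D'"
    and D: "\<forall>a b. \<forall>x\<in>U. christoffel D a b x = 0" and T: "convex T"
  shows "geodesic_on U D' T c \<longleftrightarrow> (\<exists>k. \<forall>t\<in>T. c t \<in> U \<and>
    (c has_vector_derivative matrix_inv (hess \<psi> (c t)) *v k) (at t within T))"
proof
  assume "geodesic_on U D' T c"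
  then obtain v w where c: "\<And>t. t \<in> T \<Longrightarrow> c t \<in> U"
    and v: "\<And>t. t \<in> T \<Longrightarrow> (c has_vector_derivative v t) (at t within T)"
    and w: "\<And>t. t \<in> T \<Longrightarrow> (v has_vector_derivative w t) (at t within T)"
    and eq: "\<And>t. t \<in> T \<Longrightarrow>
      w t + (\<Sum>a\<in>UNIV. \<Sum>b\<in>UNIV. (v t $ a * v t $ b) *\<^sub>R christoffel D' a b (c t)) = 0"
    unfolding geodesic_on_def by blast
  have "((\<lambda>t. hess \<psi> (c t) *v v t) has_vector_derivative 0) (at t within T)" if t: "t \<in> T" for t
  proof -
    \<comment> \<open>By the product rule the p-velocity changes at the rate given by the Hessian
      applied to the left side of the geodesic equation.\<close>
    have "((\<lambda>t. hess \<psi> (c t) *v v t) has_vector_derivative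
        (hess \<psi> (c t) *v w t + frechet_derivative (hess \<psi>) (at (c t)) (v t) *v v t)) (at t within T)"
      by (intro bounded_bilinear.has_vector_derivative[OF bounded_bilinear_matrix_vector_mult]
          has_vector_derivative_has_derivative_compose[OF v] hess_has_derivative w c t)
    also have "hess \<psi> (c t) *v w t + frechet_derivative (hess \<psi>) (at (c t)) (v t) *v v t
      = hess \<psi> (c t) *v (w t + (\<Sum>a\<in>UNIV. \<Sum>b\<in>UNIV. (v t $ a * v t $ b) *\<^sub>R christoffel D' a b (c t)))"
      by (simp add: matrix_vector_right_distrib hess_christoffel_dual_sum[OF dual D c[OF t]])
    also have "\<dots> = 0"
      using eq[OF t] by simp
    finally show ?thesis .
  qed
  from has_vector_derivative_zero_constant[OF T this]
  obtain k where k: "\<And>t. t \<in> T \<Longrightarrow> hess \<psi> (c t) *v v t = k"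
    by blast
  have "v t = matrix_inv (hess \<psi> (c t)) *v k" if "t \<in> T" for t
    using k[OF that] matrix_inverse_vector_cancel(1)[OF matrix_inv_hess[OF c[OF that]], of "v t"] by simp
  then show "\<exists>k. \<forall>t\<in>T. c t \<in> U \<and>
      (c has_vector_derivative matrix_inv (hess \<psi> (c t)) *v k) (at t within T)"
    using c v by metis
next
  assume "\<exists>k. \<forall>t\<in>T. c t \<in> U \<and>
      (c has_vector_derivative matrix_inv (hess \<psi> (c t)) *v k) (at t within T)"
  then obtain k where c: "\<And>t. t \<in> T \<Longrightarrow> c t \<in> U"
    and c': "\<And>t. t \<in> T \<Longrightarrow> (c has_vector_derivative matrix_inv (hess \<psi> (c t)) *v k) (at t within T)"
    by blast
  define v where "v t = matrix_inv (hess \<psi> (c t)) *v k" for t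
  \<comment> \<open>This is the derivative of \<open>v\<close> obtained by differentiating the
    inverse Hessian along \<open>c\<close>; \<open>hess_christoffel_dual_sum\<close> identifies it
    with minus the Christoffel term.\<close>
  define w where "w t = - (matrix_inv (hess \<psi> (c t)) *v
      (frechet_derivative (hess \<psi>) (at (c t)) (v t) *v v t))" for t
  have v: "(v has_vector_derivative w t) (at t within T)" if t: "t \<in> T" for t
    unfolding v_def[abs_def] w_def
    by (rule has_vector_derivative_has_derivative_compose[OF c'[OF t]
          has_derivative_inverse_matrix_vector_mult[OF open_U c[OF t] hess_has_derivative matrix_inv_hess]])
  have eq: "w t + (\<Sum>a\<in>UNIV. \<Sum>b\<in>UNIV. (v t $ a * v t $ b) *\<^sub>R christoffel D' a b (c t)) = 0"
    if t: "t \<in> T" for t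
  proof -
    note inv = matrix_inverse_vector_cancel(1)[OF matrix_inv_hess[OF c[OF t]]]
    show ?thesis
      unfolding w_def hess_christoffel_dual_sum[OF dual D c[OF t], symmetric] inv by simp
  qed
  show "geodesic_on U D' T c"
    unfolding geodesic_on_def using c c' v eq by (intro exI[of _ v] exI[of _ w]) (simp add: v_def)
qed

text \<open>Subtracting \<open>t *\<^sub>R k\<close> from the p-coordinates leaves a function with
  zero derivative. This serves both to find the end point from \<open>k\<close> and to recover
  \<open>k\<close> from the end points.\<close>

lemma grad_along_dual_geodesic:
  assumes T: "convex T" "s \<in> T" "t \<in> T" and c: "\<And>t. t \<in> T \<Longrightarrow> c t \<in> U"
    and c': "\<And>t. t \<in> T \<Longrightarrow> (c has_vector_derivative matrix_inv (hess \<psi> (c t)) *v k) (at t within T)"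
  shows "grad \<psi> (c t) = grad \<psi> (c s) + (t - s) *\<^sub>R k"
proof -
  have "((\<lambda>t. grad \<psi> (c t) - t *\<^sub>R k) has_vector_derivative 0) (at t within T)" if t: "t \<in> T" for t
  proof -
    have "((\<lambda>t. grad \<psi> (c t)) has_vector_derivative k) (at t within T)"
      using has_vector_derivative_has_derivative_compose[OF c'[OF t] grad_has_derivative[OF c[OF t]]]
      by (simp add: matrix_inverse_vector_cancel[OF matrix_inv_hess[OF c[OF t]]])
    moreover have "((\<lambda>t. t *\<^sub>R k) has_vector_derivative k) (at t within T)"
      by (auto intro!: derivative_eq_intros)
    ultimately show ?thesis
      using has_vector_derivative_diff by fastforce
  qed
  from has_vector_derivative_zero_constant[OF T(1) this]
  obtain d where "\<And>t. t \<in> T \<Longrightarrow> grad \<psi> (c t) - t *\<^sub>R k = d"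
    by blast
  from this[OF T(2)] this[OF T(3)] show ?thesis
    by (simp add: algebra_simps)
qed

lemma contact_ham_vf_on_legendre_submanifold:
  assumes C: "open C" "(x, grad \<psi> x, \<psi> x) \<in> C" and x: "x \<in> U"
    and h: "\<And>x p z. (x, p, z) \<in> C \<Longrightarrow> h (x, p, z) = (grad \<psi> x - p) \<bullet> F x + \<Gamma> (\<psi> x - z)"
    and F: "F differentiable (at x)" and \<Gamma>: "\<Gamma> differentiable (at 0)" "\<Gamma> 0 = 0"
  shows "h (x, grad \<psi> x, \<psi> x) = 0"
    and "contact_ham_vf h (x, grad \<psi> x, \<psi> x) = (F x, hess \<psi> x *v F x, grad \<psi> x \<bullet> F x)"
proof -
  let ?q = "(x, grad \<psi> x, \<psi> x)"
  show h0: "h ?q = 0"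
    using h[OF C(2)] \<Gamma>(2) by simp
  obtain F' \<Gamma>' where F': "(F has_derivative F') (at x)" and \<Gamma>': "(\<Gamma> has_derivative \<Gamma>') (at 0)"
    using F \<Gamma>(1) unfolding differentiable_def by blast
  define c where "c = \<Gamma>' 1"
  have \<Gamma>'_eq: "\<Gamma>' s = c * s" for s
    using linear_cmul[OF has_derivative_linear[OF \<Gamma>'], of s 1] by (simp add: c_def)
  have fst: "(fst has_derivative fst) (at ?q)"
    by (rule has_derivative_fst[OF has_derivative_ident])
  have fst_compose: "((\<lambda>q. f (fst q)) has_derivative (\<lambda>r. f' (fst r))) (at ?q)"
    if "(f has_derivative f') (at x)" for f :: "real^'n \<Rightarrow> 'z::real_normed_vector" and f'
    using has_derivative_compose[OF fst, of f f'] that by simp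
  let ?h = "\<lambda>q. (grad \<psi> (fst q) - fst (snd q)) \<bullet> F (fst q) + \<Gamma> (\<psi> (fst q) - snd (snd q))"
  \<comment> \<open>Product rule; the summand with \<open>F'\<close> vanishes because p is
    \<open>grad \<psi> x\<close> at \<open>?q\<close>.\<close>
  let ?h' = "\<lambda>r. (grad \<psi> (fst ?q) - fst (snd ?q)) \<bullet> F' (fst r)
      + (hess \<psi> x *v fst r - fst (snd r)) \<bullet> F (fst ?q) + \<Gamma>' (grad \<psi> x \<bullet> fst r - snd (snd r))"
  have "((\<lambda>q. \<psi> (fst q) - snd (snd q)) has_derivative (\<lambda>r. grad \<psi> x \<bullet> fst r - snd (snd r))) (at ?q)"
    by (intro has_derivative_diff has_derivative_snd has_derivative_ident
        fst_compose[OF potential_has_derivative[OF x]])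
  from has_derivative_compose[OF this, of \<Gamma> \<Gamma>'] \<Gamma>'
  have "((\<lambda>q. \<Gamma> (\<psi> (fst q) - snd (snd q))) has_derivative
      (\<lambda>r. \<Gamma>' (grad \<psi> x \<bullet> fst r - snd (snd r)))) (at ?q)"
    by simp
  then have "(?h has_derivative ?h') (at ?q)"
    by (intro has_derivative_add has_derivative_inner has_derivative_diff has_derivative_fst has_derivative_snd
        has_derivative_ident fst_compose[OF grad_has_derivative[OF x]] fst_compose[OF F'])
  \<comment> \<open>The formula for \<open>h\<close> holds on the open set \<open>C\<close>, hence
    near \<open>?q\<close>.\<close>
  then have "(h has_derivative ?h') (at ?q)"
    by (rule has_derivative_transform_within_open[OF _ C]) (use h in auto)
  moreover have "?h' = (\<lambda>(u, w, s). (hess \<psi> x *v F x + c *\<^sub>R grad \<psi> x) \<bullet> u - F x \<bullet> w + (- c) * s)"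
  proof -
    have "(hess \<psi> x *v u) \<bullet> F x = (hess \<psi> x *v F x) \<bullet> u" for u
      by (metis dot_lmul_matrix hess_sym[OF x] inner_commute transpose_matrix_vector)
    then show ?thesis
      by (auto simp: fun_eq_iff \<Gamma>'_eq inner_diff_left inner_add_left inner_commute[of "F x"] algebra_simps)
  qed
  ultimately have "(h has_derivative (\<lambda>(u, w, s). (hess \<psi> x *v F x + c *\<^sub>R grad \<psi> x) \<bullet> u
      - F x \<bullet> w + (- c) * s)) (at ?q)"
    by (simp only:)
  from contact_ham_vf_eq[OF this] show "contact_ham_vf h ?q = (F x, hess \<psi> x *v F x, grad \<psi> x \<bullet> F x)"
    by (simp add: h0)
qed

end

section \<open>Integral curves of the restricted contact Hamiltonian field as dual geodesics\<close>

theorem theorem3p1: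
  fixes C :: "'n::finite pt set" and U :: "(real^'n) set"
    and \<psi> \<phi> :: "real^'n \<Rightarrow> real" and \<Gamma> :: "real \<Rightarrow> real"
    and g ginv :: "real^'n \<Rightarrow> real^'n^'n" and F :: "real^'n \<Rightarrow> real^'n"
    and h :: "'n pt \<Rightarrow> real"
    and nabla nabla_star :: "'n cov_deriv"
    and p' p'' :: "real^'n" and q' q'' :: "'n pt"
  assumes C: "open C" "fst ` C = U" "legendre_submanifold U \<psi> \<subseteq> C"
    and psi: "smooth_on \<psi> U" "strictly_convex_on U \<psi>"
    and sc: "simply_connected (legendre_submanifold U \<psi>)"
    and g: "g = hess \<psi>" "riemannian_metric U g"
    and nabla: "affine_connection U nabla" "\<forall>a b. \<forall>x\<in>U. christoffel nabla a b x = 0"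
    and nabla_star: "affine_connection U nabla_star" "dual_connections U g nabla nabla_star"
    and phi: "\<phi> = legendre_transform U \<psi>"
    and ginv: "\<forall>x\<in>U. ginv x = hess \<phi> (grad \<psi> x)"
    and F: "\<forall>x\<in>U. \<forall>a. F x $ a = (\<Sum>j\<in>UNIV. ginv x $ a $ j * (p'' $ j - p' $ j))"
    and Gam: "smooth_on \<Gamma> UNIV" "\<Gamma> 0 = 0" "\<forall>s. s \<noteq> 0 \<longrightarrow> \<Gamma> s \<noteq> 0"
    and h: "\<forall>(x, p, z)\<in>C. h (x, p, z) =
              (\<Sum>a\<in>UNIV. (pd a \<psi> x - p $ a) * F x $ a) + \<Gamma> (\<psi> x - z)"
    and q': "q' \<in> legendre_submanifold U \<psi>" "fst (snd q') = p'"
    and q'': "q'' \<in> legendre_submanifold U \<psi>" "fst (snd q'') = p''"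
  shows
    "(\<forall>(x, p, z)\<in>legendre_submanifold U \<psi>.
        h (x, p, z) = 0 \<and>
        contact_ham_vf h (x, p, z) =
          (F x, frechet_derivative (grad \<psi>) (at x) (F x), frechet_derivative \<psi> (at x) (F x))) \<and>
     (\<forall>\<gamma>. integral_curve_in (legendre_submanifold U \<psi>) (contact_ham_vf h) {0..1} \<gamma> \<and> \<gamma> 0 = q'
        \<longleftrightarrow> geodesic_joining U \<psi> nabla_star q' q'' \<gamma>) \<and>
     (U = UNIV \<or> closed_segment p' p'' \<subseteq> grad \<psi> ` U \<longrightarrow>
        (\<exists>\<gamma>. geodesic_joining U \<psi> nabla_star q' q'' \<gamma>))"
proof -
  have openU: "open U"
    using open_fst_image[OF C(1)] C(2) by simp
  interpret hessian_potential U \<psi>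
    using openU psi g by unfold_locales (simp_all add: strictly_convex_on_def)
  let ?A = "legendre_submanifold U \<psi>" and ?X = "contact_ham_vf h" and ?T = "{0..1::real}"
  define k where "k = p'' - p'"
  have F_eq: "F x = matrix_inv (hess \<psi> x) *v k" if "x \<in> U" for x
    using that F ginv phi
    by (simp add: vec_eq_iff matrix_vector_mult_def k_def hess_legendre_transform)
  have F_diff: "F differentiable (at x)" if x: "x \<in> U" for x
  proof -
    have "((\<lambda>x. matrix_inv (hess \<psi> x) *v k) has_derivative (\<lambda>u. - (matrix_inv (hess \<psi> x) *v
        (frechet_derivative (hess \<psi>) (at x) u *v (matrix_inv (hess \<psi> x) *v k))))) (at x)"
      by (rule has_derivative_inverse_matrix_vector_mult[OF open_U x hess_has_derivative matrix_inv_hess])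
    from has_derivative_transform_within_open[OF this open_U x, of F] F_eq show ?thesis
      unfolding differentiable_def by metis
  qed
  have h': "h (x, p, z) = (grad \<psi> x - p) \<bullet> F x + \<Gamma> (\<psi> x - z)" if "(x, p, z) \<in> C" for x p z
    using h that by (auto simp: grad_def inner_vec_def)
  have \<Gamma>_diff: "\<Gamma> differentiable (at 0)"
    by (rule smooth_on_imp_differentiable[OF Gam(1)]) auto
  have point: "(x, grad \<psi> x, \<psi> x) \<in> C" if "x \<in> U" for x
    using C(3) that by (auto simp: legendre_submanifold_def)
  have ham: "h (x, grad \<psi> x, \<psi> x) = 0"
    "?X (x, grad \<psi> x, \<psi> x) = (F x, hess \<psi> x *v F x, grad \<psi> x \<bullet> F x)" if "x \<in> U" for x
    by (rule contact_ham_vf_on_legendre_submanifold[OF C(1) point[OF that] that _ F_diff[OF that] \<Gamma>_diff Gam(2)];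
        rule h'; assumption)+
  have mem_A: "q \<in> ?A \<longleftrightarrow> fst q \<in> U \<and> q = (fst q, grad \<psi> (fst q), \<psi> (fst q))" for q
    by (cases q) (auto simp: legendre_submanifold_def)
  obtain x' x'' where x': "x' \<in> U" "q' = (x', grad \<psi> x', \<psi> x')" "p' = grad \<psi> x'"
    and x'': "x'' \<in> U" "q'' = (x'', grad \<psi> x'', \<psi> x'')" "p'' = grad \<psi> x''"
    using q' q'' mem_A by (metis fst_conv snd_conv)
  note geodesic_iff = dual_geodesic_on_iff[OF nabla_star(2)[unfolded g(1)] nabla(2) convex_real_interval(5)]
  have vf: "\<forall>(x, p, z)\<in>?A. h (x, p, z) = 0 \<and> ?X (x, p, z) =
      (F x, frechet_derivative (grad \<psi>) (at x) (F x), frechet_derivative \<psi> (at x) (F x))"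
  proof clarify
    fix x p z assume "(x, p, z) \<in> ?A"
    then have x: "x \<in> U" and pz: "p = grad \<psi> x" "z = \<psi> x"
      by (auto simp: legendre_submanifold_def)
    show "h (x, p, z) = 0 \<and> ?X (x, p, z) =
      (F x, frechet_derivative (grad \<psi>) (at x) (F x), frechet_derivative \<psi> (at x) (F x))"
      using ham[OF x] frechet_derivative_at[OF grad_has_derivative[OF x]]
        frechet_derivative_at[OF potential_has_derivative[OF x]]
      unfolding pz by metis
  qed
  \<comment> \<open>By the chain rule, the p- and z-components of the field are the velocities of
    \<open>grad \<psi> (c t)\<close> and \<open>\<psi> (c t)\<close> when \<open>c\<close> follows
    \<open>F\<close>.\<close>
  have lift: "((\<lambda>t. (c t, grad \<psi> (c t), \<psi> (c t))) has_vector_derivative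
      ?X (c t, grad \<psi> (c t), \<psi> (c t))) (at t within ?T)"
    if "c t \<in> U" "(c has_vector_derivative F (c t)) (at t within ?T)" for c t
    unfolding ham(2)[OF that(1)]
    by (intro has_vector_derivative_Pair that
        has_vector_derivative_has_derivative_compose[OF that(2) grad_has_derivative]
        has_vector_derivative_has_derivative_compose[OF that(2) potential_has_derivative])
  have flow: "integral_curve_in ?A ?X ?T \<gamma> \<and> \<gamma> 0 = q' \<longleftrightarrow> geodesic_joining U \<psi> nabla_star q' q'' \<gamma>" for \<gamma>
  proof
    assume \<gamma>: "integral_curve_in ?A ?X ?T \<gamma> \<and> \<gamma> 0 = q'"
    define c where "c t = fst (\<gamma> t)" for t
    have A: "\<gamma> t \<in> ?A" and c: "c t \<in> U" "\<gamma> t = (c t, grad \<psi> (c t), \<psi> (c t))" if "t \<in> ?T" for t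
      using \<gamma> that mem_A unfolding integral_curve_in_def c_def by blast+
    have c': "(c has_vector_derivative matrix_inv (hess \<psi> (c t)) *v k) (at t within ?T)" if t: "t \<in> ?T" for t
    proof -
      have "(\<gamma> has_vector_derivative ?X (\<gamma> t)) (at t within ?T)"
        using \<gamma> t unfolding integral_curve_in_def by blast
      then have "(c has_vector_derivative fst (?X (\<gamma> t))) (at t within ?T)"
        unfolding c_def[abs_def]
        by (rule has_vector_derivative_has_derivative_compose[OF _ has_derivative_fst[OF has_derivative_ident]])
      then show ?thesis
        unfolding c(2)[OF t] ham(2)[OF c(1)[OF t]] by (simp add: F_eq c(1)[OF t])
    qed
    have "geodesic_on U nabla_star ?T c"
      unfolding geodesic_iff using c(1) c' by blast
    \<comment> \<open>Over unit time the p-coordinates move from \<open>p'\<close> by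
      \<open>k\<close>, hence to \<open>p''\<close>; injectivity of the gradient identifies the
      point.\<close>
    moreover have "\<gamma> 1 = q''"
    proof -
      have "c 0 = x'"
        using \<gamma> x'(2) by (simp add: c_def)
      then have "grad \<psi> (c 1) = grad \<psi> x''"
        using grad_along_dual_geodesic[of ?T 0 1 c k] c(1) c' x'(3) x''(3) by (simp add: k_def)
      then have "c 1 = x''"
        using inj_onD[OF inj_on_grad] c(1)[of 1] x''(1) by simp
      then show ?thesis
        using c(2)[of 1] x''(2) by simp
    qed
    ultimately show "geodesic_joining U \<psi> nabla_star q' q'' \<gamma>"
      using A \<gamma> unfolding geodesic_joining_def c_def[abs_def] by blast
  next
    assume \<gamma>: "geodesic_joining U \<psi> nabla_star q' q'' \<gamma>"
    define c where "c t = fst (\<gamma> t)" for t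
    have A: "\<gamma> t \<in> ?A" and c: "c t \<in> U" "\<gamma> t = (c t, grad \<psi> (c t), \<psi> (c t))" if "t \<in> ?T" for t
      using \<gamma> that mem_A unfolding geodesic_joining_def c_def by blast+
    have "geodesic_on U nabla_star ?T c" and ends: "\<gamma> 0 = q'" "\<gamma> 1 = q''"
      using \<gamma> unfolding geodesic_joining_def c_def[abs_def] by blast+
    then obtain l where c': "\<And>t. t \<in> ?T \<Longrightarrow>
        (c has_vector_derivative matrix_inv (hess \<psi> (c t)) *v l) (at t within ?T)"
      unfolding geodesic_iff by blast
    have "c 0 = x'" "c 1 = x''"
      using ends x'(2) x''(2) by (simp_all add: c_def)
    \<comment> \<open>The p-displacement over the unit interval is \<open>l\<close>, and the end
      points force it to be \<open>p'' - p'\<close>.\<close>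
    then have "l = k"
      using grad_along_dual_geodesic[of ?T 0 1 c l] c(1) c' x'(3) x''(3) by (simp add: k_def)
    then have F': "(c has_vector_derivative F (c t)) (at t within ?T)" if "t \<in> ?T" for t
      using c' that c(1) F_eq by simp
    \<comment> \<open>The curve agrees with the lift of \<open>c\<close> on \<open>?T\<close>, which
      suffices for a derivative within \<open>?T\<close>.\<close>
    have "(\<gamma> has_vector_derivative ?X (\<gamma> t)) (at t within ?T)" if t: "t \<in> ?T" for t
      using has_vector_derivative_transform[OF t c(2) lift[OF c(1)[OF t] F'[OF t]]] c(2)[OF t] by simp
    then show "integral_curve_in ?A ?X ?T \<gamma> \<and> \<gamma> 0 = q'"
      unfolding integral_curve_in_def using A ends(1) by blast
  qed
  have "\<exists>\<gamma>. geodesic_joining U \<psi> nabla_star q' q'' \<gamma>"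
    if "U = UNIV \<or> closed_segment p' p'' \<subseteq> grad \<psi> ` U"
  proof -
    have seg: "closed_segment p' p'' \<subseteq> grad \<psi> ` U"
      using that
    proof
      assume "U = UNIV"
      then show ?thesis
        using x' x'' by (intro closed_segment_subset convex_grad_image) auto
    qed
    \<comment> \<open>The straight segment from \<open>p'\<close> to \<open>p''\<close> in the
      affine coordinates p, pulled back to the chart x.\<close>
    define c where "c t = grad_inv (p' + t *\<^sub>R k)" for t
    have c: "c t \<in> U" "grad \<psi> (c t) = p' + t *\<^sub>R k" if "t \<in> ?T" for t
    proof -
      have "p' + t *\<^sub>R k \<in> closed_segment p' p''"
        using that unfolding in_segment(1) k_def by (intro exI[of _ t]) (auto simp: algebra_simps)
      with seg obtain y where "y \<in> U" "grad \<psi> y = p' + t *\<^sub>R k"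
        by (metis imageE subsetD)
      then show "c t \<in> U" "grad \<psi> (c t) = p' + t *\<^sub>R k"
        unfolding c_def by (metis grad_inv_grad)+
    qed
    have c': "(c has_vector_derivative matrix_inv (hess \<psi> (c t)) *v k) (at t within ?T)" if t: "t \<in> ?T" for t
    proof -
      have "((\<lambda>t. p' + t *\<^sub>R k) has_vector_derivative k) (at t within ?T)"
        by (auto intro!: derivative_eq_intros)
      from has_vector_derivative_has_derivative_compose[OF this
          grad_inv_has_derivative[OF c(1)[OF t], unfolded c(2)[OF t]]]
      show ?thesis
        unfolding c_def[abs_def] .
    qed
    have "geodesic_on U nabla_star ?T c"
      unfolding geodesic_iff using c(1) c' by blast
    moreover have "c 0 = x'" "c 1 = x''"
      using x' x'' by (simp_all add: c_def k_def)
    ultimately show ?thesis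
      unfolding geodesic_joining_def using c(1) x'(2) x''(2)
      by (intro exI[of _ "\<lambda>t. (c t, grad \<psi> (c t), \<psi> (c t))"]) (simp add: mem_A)
  qed
  with vf flow show ?thesis
    by blast
qed

end
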